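(* Let $X$ be a real $n\times p$ matrix of rank $p$, $p<n$, and let $V$ be a real symmetric non-negative definite non-zero $n\times n$ matrix of rank $k<n$. Consider the normal linear mixed model with two variance components $Y\sim N(X\beta,\ \sigma_1^2V+\sigma_2^2I_n)$. Let $d_0$ be the number of distinct eigenvalues of $V$, and let $d$ be the number of distinct eigenvalues of $BVB'$, where $B$ is any $(n-p)\times n$ matrix with $BB'=I_{n-p}$ and $B'B=I_n-XX^{+}$. If $$\mathcal M([X,V])\subsetneq\mathbb R^n,$$ then the ML degree of the model is bounded from above by $2d+d_0-4$.
   Context: For a matrix $A$, $A'$ is its transpose, $A^{+}$ its Moore-Penrose inverse, $\mathcal M(A)$ its column space; $[X,V]$ is the block matrix with blocks $X$ and $V$. Parameters: $\beta\in\mathbb R^p$ and $s=(\sigma_1^2,\sigma_2^2)'$ with $\sigma_1^2\ge0$, $\sigma_2^2>0$; put $\Sigma(s)=\sigma_1^2V+\sigma_2^2I_n$. The eigenvalues of $BVB'$ do not depend on the choice of $B$. Up to an additive constant, twice the log-likelihood is $l_0(\beta,s,Y)=-\log|\Sigma(s)|-(Y-X\beta)'\Sigma^{-1}(s)(Y-X\beta)$. The ML equations are obtained by setting to zero the partial derivatives of $l_0$ with respect to $\beta,\sigma_1^2,\sigma_2^2$ (computed as for real variables). For $Y=y$ they read $$X'\Sigma^{-1}(y-X\beta)=0,\quad \operatorname{tr}(\Sigma^{-1}V)=(y-X\beta)'\Sigma^{-1}V\Sigma^{-1}(y-X\beta),\quad \operatorname{tr}(\Sigma^{-1})=(y-X\beta)'\Sigma^{-2}(y-X\beta),$$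 with $\Sigma=\Sigma(s)$. A complex solution is a pair $(\beta,s)\in\mathbb C^p\times\mathbb C^2$ with $\Sigma(s)$ invertible satisfying these rational equations (with $'$ denoting plain transpose, no conjugation). The ML degree is the number of complex solutions of the ML equations when the data $y\in\mathbb R^n$ are generic, i.e. lie outside an exceptional Lebesgue-null set. Thus "the ML degree is bounded from above by $N$" means that for Lebesgue-almost every $y\in\mathbb R^n$ the ML equations have at most $N$ complex solutions. *)

theory Defs
  imports "HOL-Analysis.Analysis"
begin

definition eigenvalues :: "'a::field^'n^'n \<Rightarrow> 'a set" where
  "eigenvalues A = {c. \<exists>v. v \<noteq> 0 \<and> A *v v = c *s v}"

definition symmetric_mat :: "'a^'n^'n \<Rightarrow> bool" where
  "symmetric_mat A \<longleftrightarrow> transpose A = A"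

definition nonneg_definite :: "real^'n^'n \<Rightarrow> bool" where
  "nonneg_definite A \<longleftrightarrow> (\<forall>x. 0 \<le> x \<bullet> (A *v x))"

text \<open>The four Penrose conditions; for every real matrix they have exactly one solution.\<close>

definition is_mp_inverse :: "real^'m^'n \<Rightarrow> real^'n^'m \<Rightarrow> bool" where
  "is_mp_inverse A G \<longleftrightarrow>
     A ** G ** A = A \<and> G ** A ** G = G \<and>
     symmetric_mat (A ** G) \<and> symmetric_mat (G ** A)"

definition mp_inverse :: "real^'m^'n \<Rightarrow> real^'n^'m" where
  "mp_inverse A = (THE G. is_mp_inverse A G)"

definition column_space :: "real^'m^'n \<Rightarrow> (real^'n) set" where
  "column_space A = span (columns A)"

text \<open>The block matrix \<open>[A, B]\<close>: its columns are indexed by the disjoint sum of the index types.\<close>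

definition block_row :: "'a^'p^'n \<Rightarrow> 'a^'q^'n \<Rightarrow> 'a^('p + 'q)^'n" where
  "block_row A B = (\<chi> i j. case j of Inl a \<Rightarrow> A $ i $ a | Inr b \<Rightarrow> B $ i $ b)"

abbreviation cvec :: "real^'n \<Rightarrow> complex^'n" where
  "cvec y \<equiv> (\<chi> i. complex_of_real (y $ i))"

abbreviation cmat :: "real^'m^'n \<Rightarrow> complex^'m^'n" where
  "cmat A \<equiv> map_matrix complex_of_real A"

text \<open>
  The covariance matrix \<open>\<Sigma>(s) = s\<^sub>1 V + s\<^sub>2 I\<close>, where
  \<open>s = (s\<^sub>1, s\<^sub>2)\<close> stands for the pair of variances, allowed to be complex.
\<close>

definition Sigma_mat :: "real^'n^'n \<Rightarrow> complex \<times> complex \<Rightarrow> complex^'n^'n" where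
  "Sigma_mat V s = map_matrix (\<lambda>a. fst s * a) (cmat V) + mat (snd s)"

text \<open>
  The score equations of \<open>- log (det \<Sigma>) - (y - X\<beta>)' \<Sigma>\<^sup>-\<^sup>1 (y - X\<beta>)\<close>, read as rational
  equations in complex unknowns \<open>\<beta>\<close> and \<open>s\<close>. Here \<open>'\<close> is the plain transpose, so
  the bilinear \<^const>\<open>scalar_product\<close> is used and not an inner product.
\<close>

definition ml_solutions ::
  "real^'p^'n \<Rightarrow> real^'n^'n \<Rightarrow> real^'n \<Rightarrow> ((complex^'p) \<times> (complex \<times> complex)) set" where
  "ml_solutions X V y = {(\<beta>, s).
     let S = Sigma_mat V s; W = matrix_inv S; r = cvec y - cmat X *v \<beta> in
       invertible S \<and>
       transpose (cmat X) *v (W *v r) = 0 \<and>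
       trace (W ** cmat V) = scalar_product r ((W ** cmat V ** W) *v r) \<and>
       trace W = scalar_product r ((W ** W) *v r)}"

text \<open>
  The ML degree is the number of complex solutions for generic data; here generic means
  outside a Lebesgue null set. The bound is an integer, so that truncated subtraction
  plays no role in it.
\<close>

definition ml_degree_at_most :: "real^'p^'n \<Rightarrow> real^'n^'n \<Rightarrow> int \<Rightarrow> bool" where
  "ml_degree_at_most X V N \<longleftrightarrow>
     (AE y in lebesgue. finite (ml_solutions X V y) \<and> int (card (ml_solutions X V y)) \<le> N)"

end

theory Submission
  imports Defs "HOL-Computational_Algebra.Polynomial"
begin

text \<open>
  The vector \<open>u = \<Sigma>\<^sup>-\<^sup>1 (y - X\<beta>)\<close> of a solution satisfies \<open>X'u = 0\<close>, so \<open>u = B'w\<close> with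
  \<open>(\<sigma>\<^sub>1\<^sup>2 M + \<sigma>\<^sub>2\<^sup>2 I) w = By\<close>, where \<open>M = BVB'\<close>. Let \<open>a\<^sub>i\<close> and \<open>m\<^sub>j\<close> be the eigenvalues of
  \<open>V\<close> and \<open>M\<close>, with multiplicity, and let \<open>z\<^sub>j\<close> be the coordinates of \<open>By\<close> in an orthonormal
  eigenbasis of \<open>M\<close>; for generic \<open>y\<close> all of them are non-zero, which excludes singular
  \<open>\<sigma>\<^sub>1\<^sup>2 M + \<sigma>\<^sub>2\<^sup>2 I\<close>. Adding \<open>\<sigma>\<^sub>1\<^sup>2\<close> times the first variance equation to \<open>\<sigma>\<^sub>2\<^sup>2\<close> times the
  second shows that a solution is determined by the ratio \<open>x = \<sigma>\<^sub>1\<^sup>2 / \<sigma>\<^sub>2\<^sup>2\<close>, which satisfies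
  \<open>(\<Sum>\<^sub>i a\<^sub>i / (1 + x a\<^sub>i)) (\<Sum>\<^sub>j z\<^sub>j\<^sup>2 / (1 + x m\<^sub>j)) = n \<Sum>\<^sub>j m\<^sub>j z\<^sub>j\<^sup>2 / (1 + x m\<^sub>j)\<^sup>2\<close>.
  The column space condition makes \<open>0\<close> an eigenvalue of both \<open>V\<close> and \<open>M\<close>. Clearing the
  \<open>d\<^sub>0 - 1\<close> and \<open>2 (d - 1)\<close> non-trivial linear denominators therefore gives a polynomial of degree
  exactly \<open>(d\<^sub>0 - 2) + 2 (d - 1)\<close>, whose leading coefficient contains the sum of the \<open>z\<^sub>j\<^sup>2\<close> with
  \<open>m\<^sub>j = 0\<close>.
\<close>

section \<open>Orthogonal diagonalization of symmetric matrices\<close>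

text \<open>The eigenvector is sought inside an invariant subspace \<open>S\<close>, so that the
  search can be repeated on the orthogonal complement of the eigenvectors already found.\<close>

lemma selfadjoint_eigenvector_exists:
  fixes f :: "'a::euclidean_space \<Rightarrow> 'a"
  assumes lin: "linear f" and sa: "\<And>x y. f x \<bullet> y = x \<bullet> f y"
    and S: "subspace S" "S \<noteq> {0}" and inv: "\<And>x. x \<in> S \<Longrightarrow> f x \<in> S"
  obtains v c where "v \<in> S" "norm v = 1" "f v = c *\<^sub>R v"
proof -
  obtain u where u: "u \<in> S" "u \<noteq> 0" using S subspace_0 by blast
  \<comment> \<open>The eigenvector maximizes the Rayleigh quotient on \<open>S\<close>.\<close>
  let ?K = "S \<inter> sphere 0 1"
  have "compact ?K"
    by (simp add: closed_subspace closed_Int_compact S)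
  moreover have "u /\<^sub>R norm u \<in> ?K"
    using u S by (simp add: subspace_scale)
  moreover have "continuous_on ?K (\<lambda>x. x \<bullet> f x)"
    by (intro continuous_intros linear_continuous_on linear_conv_bounded_linear[THEN iffD1] lin)
  ultimately obtain v where v: "v \<in> ?K" "\<And>x. x \<in> ?K \<Longrightarrow> x \<bullet> f x \<le> v \<bullet> f v"
    using continuous_attains_sup[of ?K "\<lambda>x. x \<bullet> f x"] by blast
  define c where "c = v \<bullet> f v"
  have vv: "v \<bullet> v = 1" using v(1) by (simp add: norm_eq_1)
  have ray: "x \<bullet> f x \<le> c * (x \<bullet> x)" if "x \<in> S" for x
  proof (cases "x = 0")
    case False
    then have "x /\<^sub>R norm x \<in> ?K" using that S by (simp add: subspace_scale)
    from v(2)[OF this] have "(x \<bullet> f x) / (norm x)\<^sup>2 \<le> c"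
      by (simp add: linear_scale[OF lin] c_def divide_simps power2_eq_square)
    then show ?thesis using False
      by (simp add: divide_le_eq dot_square_norm)
  qed (simp add: linear_0[OF lin])
  define h where "h = f v - c *\<^sub>R v"
  have hS: "h \<in> S" using v(1) inv S by (simp add: h_def subspace_diff subspace_scale)
  define C where "C = c * (h \<bullet> h) - h \<bullet> f h"
  \<comment> \<open>Perturbing \<open>v\<close> along the residual \<open>h\<close> cannot beat the
    maximal quotient \<open>c\<close>. The terms in \<open>v \<bullet> h\<close> cancel and leave a
    quadratic in \<open>t\<close> whose linear coefficient is
    \<open>- 2 * (h \<bullet> h)\<close>.\<close>
  have quad: "0 \<le> - 2 * t * (h \<bullet> h) + t\<^sup>2 * C" for t
  proof -
    have "v + t *\<^sub>R h \<in> S" using v(1) hS S by (simp add: subspace_add subspace_scale)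
    from ray[OF this]
    have "c + t * (v \<bullet> f h) + t * (h \<bullet> f v) + t\<^sup>2 * (h \<bullet> f h)
      \<le> c * (1 + 2 * t * (v \<bullet> h) + t\<^sup>2 * (h \<bullet> h))"
      by (simp add: linear_add[OF lin] linear_scale[OF lin] inner_add inner_commute
          c_def[symmetric] vv power2_eq_square algebra_simps)
    moreover have "v \<bullet> f h = h \<bullet> f v" by (metis sa inner_commute)
    moreover have "h \<bullet> f v = h \<bullet> h + c * (v \<bullet> h)"
      by (simp add: h_def inner_diff inner_commute vv c_def algebra_simps)
    ultimately show ?thesis by (simp add: C_def algebra_simps)
  qed
  have "h \<bullet> h = 0"
  proof (rule ccontr)
    assume "h \<bullet> h \<noteq> 0"
    then have hh: "h \<bullet> h > 0" by simp
    show False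
    \<comment> \<open>For positive \<open>C\<close> the quadratic is tested at its minimizer
      \<open>t = q / C\<close>; otherwise \<open>t = 1\<close> already makes it negative.\<close>
    proof (cases "C > 0")
      case True
      define q where "q = h \<bullet> h"
      have "- 2 * (q / C) * q + (q / C)\<^sup>2 * C = - (q * q / C)"
        using True by (simp add: power2_eq_square field_simps)
      moreover have "q * q / C > 0" using True hh by (simp add: q_def)
      ultimately show False using quad[of "q / C"] unfolding q_def by linarith
    next
      case False
      with quad[of 1] hh show False by simp
    qed
  qed
  then have "f v = c *\<^sub>R v" by (simp add: h_def)
  with v(1) that show ?thesis by auto
qed

text \<open>Induction on the number of eigenvectors: fewer than \<open>DIM('a)\<close> of them leave
  a non-zero orthogonal complement, which is invariant because \<open>f\<close> is
  self-adjoint.\<close>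

lemma selfadjoint_orthonormal_eigenvectors:
  fixes f :: "'a::euclidean_space \<Rightarrow> 'a"
  assumes lin: "linear f" and sa: "\<And>x y. f x \<bullet> y = x \<bullet> f y"
    and "m \<le> DIM('a)"
  shows "\<exists>b. finite b \<and> card b = m \<and> pairwise orthogonal b \<and>
    (\<forall>v\<in>b. norm v = 1 \<and> (\<exists>c. f v = c *\<^sub>R v))"
  using assms(3)
proof (induction m)
  case 0
  show ?case by (rule exI[of _ "{}"]) simp
next
  case (Suc m)
  then obtain b where b: "finite b" "card b = m" "pairwise orthogonal b"
    "\<And>v. v \<in> b \<Longrightarrow> norm v = 1" "\<And>v. v \<in> b \<Longrightarrow> \<exists>c. f v = c *\<^sub>R v" by auto
  let ?S = "{x. \<forall>v\<in>b. orthogonal v x}"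
  have "dim (span b) < DIM('a)"
    using dim_le_card'[OF b(1)] b(2) Suc.prems by simp
  then obtain u where "u \<noteq> 0" "\<And>y. y \<in> span (span b) \<Longrightarrow> orthogonal u y"
    using orthogonal_to_subspace_exists[of "span b"] by (metis dim_span)
  then have "u \<in> ?S" "u \<noteq> 0" by (auto simp: orthogonal_commute span_base)
  then have "?S \<noteq> {0}" by blast
  moreover have "subspace ?S"
    by (auto simp: subspace_def orthogonal_def inner_add)
  moreover have "f x \<in> ?S" if x: "x \<in> ?S" for x
  proof -
    have "v \<bullet> f x = 0" if v: "v \<in> b" for v
    proof -
      obtain c where "f v = c *\<^sub>R v" using b(5) v by blast
      with x v show ?thesis by (simp add: sa[symmetric] orthogonal_def)
    qed
    then show ?thesis by (simp add: orthogonal_def)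
  qed
  ultimately obtain v c where v: "v \<in> ?S" "norm v = 1" "f v = c *\<^sub>R v"
    using selfadjoint_eigenvector_exists[OF lin sa, of ?S] by blast
  have "v \<notin> b" using v by (auto simp: orthogonal_def)
  moreover have "pairwise orthogonal (insert v b)"
    using b(3) v(1) by (auto simp: pairwise_insert orthogonal_def inner_commute)
  ultimately show ?case using b v
    by (intro exI[of _ "insert v b"] conjI ballI) auto
qed

definition diag_mat :: "('n::finite \<Rightarrow> 'a::zero) \<Rightarrow> 'a^'n^'n" where
  "diag_mat f = (\<chi> i j. if i = j then f i else 0)"

lemma diag_mat_vec: "diag_mat f *v x = (\<chi> i. f i * x $ i)" for x :: "'a::semiring_1^'n"
  by (simp add: diag_mat_def matrix_vector_mult_def if_distrib if_distribR cong: if_cong)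

lemma diag_mat_mult: "diag_mat f ** diag_mat g = diag_mat (\<lambda>i. f i * g i)"
  for f :: "'n::finite \<Rightarrow> 'a::semiring_1"
  by (simp add: matrix_eq matrix_vector_mul_assoc[symmetric] diag_mat_vec mult.assoc)

lemma transpose_diag_mat [simp]: "transpose (diag_mat f) = diag_mat f"
  by (auto simp: diag_mat_def transpose_def vec_eq_iff)

lemma trace_diag_mat [simp]: "trace (diag_mat f) = (\<Sum>i\<in>UNIV. f i)"
  by (simp add: diag_mat_def trace_def)

text \<open>The columns of \<open>Q\<close> are an orthonormal eigenbasis indexed by the type
  \<open>'n\<close> itself; \<open>a\<close> lists the eigenvalues with multiplicity.\<close>

lemma symmetric_mat_diagonalization:
  fixes A :: "real^'n^'n"
  assumes "symmetric_mat A"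
  obtains Q :: "real^'n^'n" and a where "transpose Q ** Q = mat 1" "Q ** transpose Q = mat 1"
    "A = Q ** diag_mat a ** transpose Q"
proof -
  have sa: "(A *v x) \<bullet> y = x \<bullet> (A *v y)" for x y
    using assms by (metis dot_lmul_matrix transpose_matrix_vector symmetric_mat_def)
  obtain b where b: "finite b" "card b = CARD('n)" "pairwise orthogonal b"
    "\<And>v. v \<in> b \<Longrightarrow> norm v = 1" "\<And>v. v \<in> b \<Longrightarrow> \<exists>c. A *v v = c *\<^sub>R v"
    using selfadjoint_orthonormal_eigenvectors[OF matrix_vector_mul_linear[of A] sa, of "CARD('n)"]
    by auto
  obtain e :: "'n \<Rightarrow> real^'n" where e: "bij_betw e UNIV b"
    using finite_same_card_bij[of "UNIV::'n set" b] b by auto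
  have eb: "e i \<in> b" for i using e by (auto simp: bij_betw_def)
  then have "\<forall>i. \<exists>c. A *v e i = c *\<^sub>R e i" using b(5) by blast
  then obtain a where a: "\<And>i. A *v e i = a i *\<^sub>R e i" by metis
  have ee: "e i \<bullet> e j = (if i = j then 1 else 0)" for i j
  proof (cases "i = j")
    case True
    then show ?thesis using b(4)[OF eb[of i]] by (simp add: norm_eq_1)
  next
    case False
    then have "e i \<noteq> e j" using e by (auto simp: bij_betw_def inj_on_def)
    then show ?thesis using False b(3) eb by (simp add: pairwise_def orthogonal_def)
  qed
  define Q :: "real^'n^'n" where "Q = transpose (\<chi> i. e i)"
  have col: "column i Q = e i" for i by (simp add: Q_def row_def vec_eq_iff)
  have QQ: "transpose Q ** Q = mat 1"
    using ee by (simp add: matrix_mult_transpose_dot_column col mat_def)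
  then have QQ': "Q ** transpose Q = mat 1" by (simp add: matrix_left_right_inverse)
  have "A ** Q = Q ** diag_mat a"
  proof -
    have "column j (A ** Q) = column j (Q ** diag_mat a)" for j
    proof -
      have "column j (A ** Q) = A *v e j" 
        using col[of j] by (auto simp: column_def matrix_matrix_mult_def matrix_vector_mult_def vec_eq_iff)
      also have "\<dots> = a j *\<^sub>R column j Q" by (simp add: a col)
      also have "\<dots> = column j (Q ** diag_mat a)"
        by (auto simp: column_def matrix_matrix_mult_def diag_mat_def vec_eq_iff if_distrib cong: if_cong)
      finally show ?thesis .
    qed
    then show ?thesis by (simp add: column_def vec_eq_iff)
  qed
  then have "A = Q ** diag_mat a ** transpose Q"
    by (metis QQ' matrix_mul_assoc matrix_mul_rid)
  then show ?thesis by (rule that[OF QQ QQ'])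
qed

text \<open>In the coordinates \<open>transpose Q *v v\<close> the eigenvalue equation reads
  \<open>a i * w $ i = c * w $ i\<close>, so a non-zero coordinate forces \<open>c = a i\<close>;
  conversely, column \<open>i\<close> of \<open>Q\<close> is an eigenvector for
  \<open>a i\<close>.\<close>

lemma eigenvalues_diagonalized:
  fixes Q :: "'a::field^'n^'n"
  assumes Q: "transpose Q ** Q = mat 1" "Q ** transpose Q = mat 1"
  shows "eigenvalues (Q ** diag_mat a ** transpose Q) = range a"
proof (intro equalityI subsetI)
  fix c assume "c \<in> eigenvalues (Q ** diag_mat a ** transpose Q)"
  then obtain v where v: "v \<noteq> 0" "Q ** diag_mat a ** transpose Q *v v = c *s v"
    by (auto simp: eigenvalues_def)
  let ?w = "transpose Q *v v"
  have "?w \<noteq> 0" using v(1) Q(2)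
    by (metis matrix_vector_mul_assoc matrix_vector_mul_lid matrix_vector_mult_0_right)
  then obtain i where i: "?w $ i \<noteq> 0" by (auto simp: vec_eq_iff)
  have "diag_mat a *v ?w = transpose Q *v (Q ** diag_mat a ** transpose Q *v v)"
    by (metis Q(1) matrix_vector_mul_assoc matrix_mul_assoc matrix_mul_lid)
  also have "\<dots> = c *s ?w" by (simp only: v(2) vector_scalar_commute)
  finally have "a i * ?w $ i = c * ?w $ i"
    unfolding diag_mat_vec by (metis vec_lambda_beta vector_smult_component)
  with i show "c \<in> range a" by auto
next
  fix c assume "c \<in> range a"
  then obtain i where i: "c = a i" by blast
  let ?v = "Q *v axis i 1"
  have Qv: "transpose Q *v ?v = axis i 1"
    by (simp only: matrix_vector_mul_assoc Q matrix_vector_mul_lid)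
  then have "?v \<noteq> 0" by (metis axis_eq_0_iff matrix_vector_mult_0_right zero_neq_one)
  moreover have "Q ** diag_mat a ** transpose Q *v ?v = Q *v (diag_mat a *v axis i 1)"
    by (metis Qv matrix_vector_mul_assoc)
  moreover have "diag_mat a *v axis i 1 = a i *s axis i 1"
    by (auto simp: diag_mat_vec vec_eq_iff axis_def)
  ultimately show "c \<in> eigenvalues (Q ** diag_mat a ** transpose Q)"
    unfolding eigenvalues_def i by (metis (mono_tags, lifting) mem_Collect_eq vector_scalar_commute)
qed

section \<open>Calculus of matrices diagonalized by one fixed orthogonal matrix\<close>

lemma matrix_inv_eqI:
  fixes A :: "'a::semiring_1^'n^'m"
  assumes "A ** C = mat 1" "C ** A = mat 1"
  shows "matrix_inv A = C"
proof -
  have "A ** matrix_inv A = mat 1 \<and> matrix_inv A ** A = mat 1"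
    unfolding matrix_inv_def by (rule someI[of _ C]) (use assms in simp)
  then show ?thesis by (metis assms(2) matrix_mul_assoc matrix_mul_lid matrix_mul_rid)
qed

text \<open>The plain transpose keeps this form under the embedding of real into complex matrices: a
  real orthogonal \<open>Q\<close> still satisfies both orthogonality identities there.\<close>

definition conj_diag :: "'a::semiring_1^'n^'n \<Rightarrow> ('n \<Rightarrow> 'a) \<Rightarrow> 'a^'n^'n" where
  "conj_diag Q f = Q ** diag_mat f ** transpose Q"

lemma diag_mat_1: "diag_mat (\<lambda>_. 1) = mat 1"
  by (simp add: diag_mat_def mat_def)

lemma conj_diag_mult:
  assumes "transpose Q ** Q = mat 1"
  shows "conj_diag Q f ** conj_diag Q g = conj_diag Q (\<lambda>i. f i * g i)"
proof -
  have "conj_diag Q f ** conj_diag Q g =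
      Q ** (diag_mat f ** ((transpose Q ** Q) ** diag_mat g)) ** transpose Q"
    by (simp only: conj_diag_def matrix_mul_assoc)
  then show ?thesis by (simp add: assms diag_mat_mult conj_diag_def)
qed

lemma trace_conj_diag:
  fixes Q :: "'a::comm_semiring_1^'n^'n"
  assumes "transpose Q ** Q = mat 1"
  shows "trace (conj_diag Q f) = (\<Sum>i\<in>UNIV. f i)"
proof -
  have "trace (conj_diag Q f) = trace (transpose Q ** (Q ** diag_mat f))"
    unfolding conj_diag_def by (rule trace_mul_sym)
  then show ?thesis by (simp add: matrix_mul_assoc assms)
qed

lemma transpose_conj_diag: "transpose (conj_diag Q f) = conj_diag Q f"
  for Q :: "'a::comm_semiring_1^'n^'n"
  by (simp add: conj_diag_def matrix_transpose_mul matrix_mul_assoc)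

text \<open>A vanishing \<open>f i\<close> would put column \<open>i\<close> of \<open>Q\<close>
  into the kernel; otherwise the entries are inverted one by one.\<close>

lemma inverse_conj_diag:
  fixes Q :: "'a::field^'n^'n"
  assumes Q: "transpose Q ** Q = mat 1" "Q ** transpose Q = mat 1"
    and inv: "invertible (conj_diag Q f)"
  shows "f i \<noteq> 0" "matrix_inv (conj_diag Q f) = conj_diag Q (\<lambda>i. 1 / f i)"
    "conj_diag Q f ** conj_diag Q (\<lambda>i. 1 / f i) = mat 1"
proof -
  obtain C where C: "C ** conj_diag Q f = mat 1"
    using inv by (auto simp: invertible_def)
  show nz: "f i \<noteq> 0" for i
  proof
    assume "f i = 0"
    then have "diag_mat f *v axis i 1 = 0" by (auto simp: diag_mat_vec vec_eq_iff axis_def)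
    moreover have "conj_diag Q f *v (Q *v axis i 1) = Q *v (diag_mat f *v ((transpose Q ** Q) *v axis i 1))"
      by (simp only: conj_diag_def matrix_vector_mul_assoc matrix_mul_assoc)
    ultimately have "conj_diag Q f *v (Q *v axis i 1) = 0" using Q(1) by simp
    then have "(transpose Q ** (C ** conj_diag Q f) ** Q) *v axis i 1 = 0"
      by (simp only: matrix_vector_mul_assoc[symmetric] matrix_vector_mult_0_right)
    then have "axis i 1 = (0 :: 'a^'n)" using C Q(1) by simp
    then show False by (simp add: axis_eq_0_iff)
  qed
  have one: "conj_diag Q (\<lambda>_. 1) = mat 1" by (simp add: conj_diag_def diag_mat_1 Q(2))
  show r: "conj_diag Q f ** conj_diag Q (\<lambda>i. 1 / f i) = mat 1"
    by (simp add: conj_diag_mult Q(1) nz one)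
  have "conj_diag Q (\<lambda>i. 1 / f i) ** conj_diag Q f = mat 1"
    by (simp add: conj_diag_mult Q(1) nz one)
  with r show "matrix_inv (conj_diag Q f) = conj_diag Q (\<lambda>i. 1 / f i)"
    by (rule matrix_inv_eqI)
qed

section \<open>The secular equation for the variance ratio\<close>

text \<open>The degree bounds need not be attained: if one is strict, both sides vanish. Leading
  coefficients can thus be computed from upper bounds alone.\<close>

lemma coeff_mult_degree_le:
  fixes p q :: "'a::comm_semiring_0 poly"
  assumes "degree p \<le> m" "degree q \<le> n"
  shows "coeff (p * q) (m + n) = coeff p m * coeff q n"
proof (cases "degree p = m \<and> degree q = n")
  case True
  then show ?thesis using coeff_mult_degree_sum[of p q] by simp
next
  case False
  then have "degree p < m \<or> degree q < n" using assms by auto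
  moreover from this have "degree (p * q) < m + n"
    using degree_mult_le[of p q] assms by linarith
  ultimately show ?thesis by (auto simp: coeff_eq_0)
qed

lemma degree_prod_linear_le: "degree (\<Prod>c\<in>A. [:1, c:]) \<le> card A"
  for A :: "'a::comm_semiring_1 set"
proof (induction A rule: infinite_finite_induct)
  case (insert c A)
  have "degree ([:1, c:] * (\<Prod>c\<in>A. [:1, c:])) \<le> 1 + card A"
    by (rule degree_mult_le[THEN order_trans]) (use insert in \<open>auto intro: add_mono\<close>)
  then show ?case using insert by simp
qed auto

lemma coeff_prod_linear_card: "finite A \<Longrightarrow> coeff (\<Prod>c\<in>A. [:1, c:]) (card A) = \<Prod>A"
  for A :: "'a::comm_semiring_1 set"
proof (induction A rule: finite_induct)
  case (insert c A)
  have "coeff ([:1, c:] * (\<Prod>c\<in>A. [:1, c:])) (1 + card A) = c * \<Prod>A"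
    by (subst coeff_mult_degree_le) (auto simp: degree_prod_linear_le insert)
  then show ?case using insert by simp
qed auto

lemma poly_prod_linear: "poly (\<Prod>c\<in>A. [:1, c:]) x = (\<Prod>c\<in>A. 1 + x * c)"
  for x :: "'a::comm_semiring_1"
  by (simp add: poly_prod)

text \<open>Multiplying the equation by \<open>P A * (P M)\<^sup>2\<close> turns every element of
  \<open>Z\<close> into a root of the polynomial \<open>R\<close>. The coefficient of
  \<open>R\<close> at \<open>D + 2 * E\<close> is non-zero, so the roots can be counted.\<close>

lemma secular_roots_bound:
  fixes a :: "'n::finite \<Rightarrow> 'a::field_char_0" and m t :: "'q::finite \<Rightarrow> 'a" and r :: 'a
  assumes a: "0 \<in> range a" "range a \<noteq> {0}"
    and m: "0 \<in> range m"
    and t: "(\<Sum>j | m j = 0. t j) \<noteq> 0"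
  defines "Z \<equiv> {x. (\<forall>i. 1 + x * a i \<noteq> 0) \<and> (\<forall>j. 1 + x * m j \<noteq> 0) \<and>
     (\<Sum>i\<in>UNIV. a i / (1 + x * a i)) * (\<Sum>j\<in>UNIV. t j / (1 + x * m j))
       = r * (\<Sum>j\<in>UNIV. m j * t j / (1 + x * m j)\<^sup>2)}"
  shows "finite Z \<and> int (card Z) \<le> 2 * int (card (range m)) + int (card (range a)) - 4"
proof -
  define A where "A = range a - {0}"
  define M where "M = range m - {0}"
  define P :: "'a set \<Rightarrow> 'a poly" where "P S = (\<Prod>c\<in>S. [:1, c:])" for S
  \<comment> \<open>Putting \<open>0\<close> back gives \<open>card (range a) = D + 2\<close> and
    \<open>card (range m) = E + 1\<close>, so the claimed bound is \<open>D + 2 * E\<close>.\<close>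
  define D where "D = card A - 1"
  define E where "E = card M"
  have fin [simp]: "finite A" "finite M" by (auto simp: A_def M_def)
  have "A \<noteq> {}" using a by (auto simp: A_def)
  then have cA: "card A = Suc D" by (simp add: D_def card_gt_0_iff Suc_diff_1)
  have degP: "degree (P S) \<le> card S" for S
    unfolding P_def by (rule degree_prod_linear_le)
  \<comment> \<open>\<open>F\<close>, \<open>G\<close> and \<open>H\<close> are the numerators of
    the three sums over the common denominators \<open>P A\<close>, \<open>P M\<close> and
    \<open>(P M)\<^sup>2\<close>. An index with eigenvalue \<open>0\<close> has denominator 1, and
    removing \<open>0\<close> accordingly changes nothing.\<close>
  define F where "F = (\<Sum>i\<in>UNIV. smult (a i) (P (A - {a i})))"
  define G where "G = (\<Sum>j\<in>UNIV. smult (t j) (P (M - {m j})))"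
  define H where "H = (\<Sum>j\<in>UNIV. smult (m j * t j) ((P (M - {m j}))\<^sup>2))"
  define R where "R = F * (G * P M) - smult r (P A * H)"

  have degA: "degree (P (A - {a i})) \<le> D" if "a i \<noteq> 0" for i
  proof -
    have "card (A - {a i}) = D" using that cA by (simp add: A_def)
    then show ?thesis using degP[of "A - {a i}"] by simp
  qed
  have degF: "degree F \<le> D"
    unfolding F_def
  proof (rule degree_sum_le)
    show "degree (smult (a i) (P (A - {a i}))) \<le> D" for i
      using degA[of i] degree_smult_le[of "a i" "P (A - {a i})"] by (cases "a i = 0") auto
  qed simp
  have coeffF: "coeff F D \<noteq> 0"
  proof -
    have "a i * coeff (P (A - {a i})) D = (if a i = 0 then 0 else \<Prod>A)" for i
    proof (cases "a i = 0")
      case False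
      then have ai: "a i \<in> A" by (simp add: A_def)
      then have "coeff (P (A - {a i})) D = \<Prod>(A - {a i})"
        using coeff_prod_linear_card[of "A - {a i}"] cA by (simp add: P_def)
      with False ai show ?thesis by (simp add: prod.remove[of A "a i"])
    qed simp
    then have "coeff F D = (\<Sum>i\<in>UNIV. if a i = 0 then 0 else \<Prod>A)"
      by (simp add: F_def coeff_sum)
    \<comment> \<open>All non-zero \<open>a i\<close> contribute the same product, so characteristic
      zero excludes cancellation.\<close>
    also have "\<dots> = of_nat (card {i. a i \<noteq> 0}) * \<Prod>A"
      by (simp add: sum.If_cases Compl_eq)
    finally have "coeff F D = of_nat (card {i. a i \<noteq> 0}) * \<Prod>A" .
    moreover have "{i. a i \<noteq> 0} \<noteq> {}" using a by auto
    ultimately show ?thesis by (auto simp: A_def card_eq_0_iff)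
  qed

  \<comment> \<open>Only indices with \<open>m j = 0\<close> keep all \<open>E\<close> factors;
    hence the top coefficient of \<open>G\<close> sees just the sum in the hypothesis
    \<open>t\<close>.\<close>
  have degM: "degree (P (M - {m j})) \<le> (if m j = 0 then E else E - 1)" for j
  proof -
    have "card (M - {m j}) = (if m j = 0 then E else E - 1)"
      by (auto simp: M_def E_def)
    then show ?thesis using degP[of "M - {m j}"] by simp
  qed
  have degG: "degree G \<le> E"
    unfolding G_def
  proof (rule degree_sum_le)
    show "degree (smult (t j) (P (M - {m j}))) \<le> E" for j
      using degM[of j] degree_smult_le[of "t j" "P (M - {m j})"] by (auto split: if_splits)
  qed simp
  have coeffG: "coeff G E \<noteq> 0"
  proof -
    have "t j * coeff (P (M - {m j})) E = (if m j = 0 then t j * \<Prod>M else 0)" for j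
    proof (cases "m j = 0")
      case True
      then have "M - {m j} = M" by (auto simp: M_def)
      with True show ?thesis
        using coeff_prod_linear_card[of M] by (simp add: P_def E_def)
    next
      case False
      then have "m j \<in> M" by (simp add: M_def)
      then have "E > 0" unfolding E_def using card_gt_0_iff by (metis fin(2) empty_iff)
      with False degM[of j] have "degree (P (M - {m j})) < E" by simp
      with False show ?thesis by (simp add: coeff_eq_0)
    qed
    then have "coeff G E = (\<Sum>j\<in>UNIV. if m j = 0 then t j * \<Prod>M else 0)"
      by (simp add: G_def coeff_sum)
    also have "\<dots> = (\<Sum>j | m j = 0. t j) * \<Prod>M"
      by (simp add: sum.If_cases sum_distrib_right)
    finally show ?thesis using t by (simp add: M_def)
  qed
  have degPM: "degree (P M) \<le> E" "coeff (P M) E \<noteq> 0"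
    using degP[of M] coeff_prod_linear_card[of M] by (auto simp: E_def P_def M_def)
  have degGP: "degree (G * P M) \<le> E + E"
    using degree_mult_le[of G "P M"] degG degPM by linarith
  have degFGP: "degree (F * (G * P M)) \<le> D + (E + E)"
    using degree_mult_le[of F "G * P M"] degF degGP by linarith
  \<comment> \<open>The factor \<open>m j\<close> removes the terms of full degree from
    \<open>H\<close>, leaving degree at most \<open>(D + 1) + 2 * (E - 1)\<close>. For
    \<open>E = 0\<close>, where this subtraction is truncated, \<open>H\<close> itself is
    zero.\<close>
  have degPAH: "P A * H = 0 \<or> degree (P A * H) < D + (E + E)"
  proof (cases "E = 0")
    case True
    then have "\<And>j. m j = 0" by (auto simp: E_def M_def)
    then show ?thesis by (simp add: H_def)
  next
    case False
    have "degree H \<le> 2 * (E - 1)" unfolding H_def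
    proof (rule degree_sum_le)
      show "degree (smult (m j * t j) ((P (M - {m j}))\<^sup>2)) \<le> 2 * (E - 1)" for j
      proof (cases "m j = 0")
        case False
        then show ?thesis
          using degM[of j] degree_power_le[of "P (M - {m j})" 2]
            degree_smult_le[of "m j * t j" "(P (M - {m j}))\<^sup>2"] by simp
      qed simp
    qed simp
    moreover have "degree (P A) \<le> Suc D" using degP[of A] cA by simp
    ultimately have "degree (P A * H) \<le> Suc D + 2 * (E - 1)"
      using degree_mult_le[of "P A" H] by linarith
    then show ?thesis using False by auto
  qed
  have "coeff R (D + (E + E)) = coeff F D * (coeff G E * coeff (P M) E)"
    using degPAH
    by (auto simp: R_def coeff_mult_degree_le degF degG degPM degGP coeff_eq_0)
  then have R0: "R \<noteq> 0" using coeffF coeffG degPM by auto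
  have degR: "degree R \<le> D + (E + E)"
    unfolding R_def
    by (rule degree_diff_le[OF degFGP])
      (use degPAH degree_smult_le[of r "P A * H"] in auto)
  have "Z \<subseteq> {x. poly R x = 0}"
  proof
    fix x assume x: "x \<in> Z"
    have nz: "1 + x * a i \<noteq> 0" "1 + x * m j \<noteq> 0" for i j using x by (auto simp: Z_def)
    have div: "poly (P (S - {c})) x = poly (P S) x / (1 + x * c)"
      if "finite S" "c = 0 \<or> c \<in> S" "1 + x * c \<noteq> 0" "0 \<notin> S" for S c
    proof -
      have "poly (P S) x = (1 + x * c) * poly (P (S - {c})) x"
      proof (cases "c \<in> S")
        case True
        then show ?thesis unfolding P_def poly_prod_linear by (rule prod.remove[OF that(1)])
      next
        case False
        then have "S - {c} = S" "c = 0" using that by auto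
        then show ?thesis by simp
      qed
      then show ?thesis using that(3) by simp
    qed
    have divA: "poly (P (A - {a i})) x = poly (P A) x / (1 + x * a i)" for i
      by (rule div) (auto simp: A_def nz)
    have divM: "poly (P (M - {m j})) x = poly (P M) x / (1 + x * m j)" for j
      by (rule div) (auto simp: M_def nz)
    have "poly F x = poly (P A) x * (\<Sum>i\<in>UNIV. a i / (1 + x * a i))"
      by (simp add: F_def poly_sum divA sum_distrib_left mult.commute)
    moreover have "poly G x = poly (P M) x * (\<Sum>j\<in>UNIV. t j / (1 + x * m j))"
      by (simp add: G_def poly_sum divM sum_distrib_left mult.commute)
    moreover have "poly H x = (poly (P M) x)\<^sup>2 * (\<Sum>j\<in>UNIV. m j * t j / (1 + x * m j)\<^sup>2)"
      by (simp add: H_def poly_sum divM sum_distrib_left mult.commute power_divide)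
    ultimately have "poly R x = poly (P A) x * (poly (P M) x)\<^sup>2 *
        ((\<Sum>i\<in>UNIV. a i / (1 + x * a i)) * (\<Sum>j\<in>UNIV. t j / (1 + x * m j))
          - r * (\<Sum>j\<in>UNIV. m j * t j / (1 + x * m j)\<^sup>2))"
      by (simp add: R_def power2_eq_square algebra_simps)
    with x show "x \<in> {x. poly R x = 0}" by (simp add: Z_def)
  qed
  moreover have roots: "finite {x. poly R x = 0}" "card {x. poly R x = 0} \<le> D + (E + E)"
    using R0 degR card_poly_roots_bound[of R] by (auto simp: poly_roots_finite)
  ultimately have "finite Z" "card Z \<le> D + (E + E)"
    using finite_subset card_mono[of "{x. poly R x = 0}" Z] by (blast, linarith)
  moreover have "card (range a) = D + 2"
    using card_Suc_Diff1[OF _ a(1)] cA by (simp add: A_def)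
  moreover have "card (range m) = E + 1"
    using card_Suc_Diff1[OF _ m] by (simp add: M_def E_def)
  ultimately show ?thesis by simp
qed

text \<open>The combination \<open>s1 * eq1 + s2 * eq2\<close> reduces the trace side to the
  dimension and so expresses \<open>s2\<close> through \<open>x\<close>; inserting this into
  \<open>eq1\<close> eliminates \<open>s2\<close>.\<close>

lemma score_equations_ratio:
  fixes a :: "'n::finite \<Rightarrow> 'a::field_char_0" and m z w :: "'q::finite \<Rightarrow> 'a" and s1 s2 :: 'a
  assumes s2: "s2 \<noteq> 0"
    and f: "\<And>i. s1 * a i + s2 \<noteq> 0" and g: "\<And>j. s1 * m j + s2 \<noteq> 0"
    and w: "\<And>j. (s1 * m j + s2) * w j = z j"
    and eq1: "(\<Sum>i\<in>UNIV. a i / (s1 * a i + s2)) = (\<Sum>j\<in>UNIV. m j * (w j)\<^sup>2)"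
    and eq2: "(\<Sum>i\<in>UNIV. 1 / (s1 * a i + s2)) = (\<Sum>j\<in>UNIV. (w j)\<^sup>2)"
  defines "x \<equiv> s1 / s2"
  shows "1 + x * a i \<noteq> 0" "1 + x * m j \<noteq> 0"
    and "of_nat CARD('n) * s2 = (\<Sum>j\<in>UNIV. (z j)\<^sup>2 / (1 + x * m j))"
    and "(\<Sum>i\<in>UNIV. a i / (1 + x * a i)) * (\<Sum>j\<in>UNIV. (z j)\<^sup>2 / (1 + x * m j))
       = of_nat CARD('n) * (\<Sum>j\<in>UNIV. m j * (z j)\<^sup>2 / (1 + x * m j)\<^sup>2)"
proof -
  have fx: "s1 * c + s2 = s2 * (1 + x * c)" for c
    using s2 by (simp add: x_def field_simps)
  show nz: "1 + x * a i \<noteq> 0" "1 + x * m j \<noteq> 0" for i j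
    using f[of i] g[of j] by (auto simp: fx)
  have wz: "w j = z j / (s2 * (1 + x * m j))" for j
    using w[of j] s2 nz(2)[of j] by (simp add: nonzero_eq_divide_eq fx mult.commute)
  have "of_nat CARD('n) = (\<Sum>i\<in>(UNIV :: 'n set). (s1 * a i + s2) / (s1 * a i + s2))"
    using f by simp
  also have "\<dots> = (\<Sum>i\<in>UNIV. s1 * (a i / (s1 * a i + s2)) + s2 * (1 / (s1 * a i + s2)))"
    by (simp only: times_divide_eq_right mult_1_right add_divide_distrib)
  also have "\<dots> = s1 * (\<Sum>j\<in>UNIV. m j * (w j)\<^sup>2) + s2 * (\<Sum>j\<in>UNIV. (w j)\<^sup>2)"
    by (simp only: sum.distrib sum_distrib_left[symmetric] eq1 eq2)
  also have "\<dots> = (\<Sum>j\<in>UNIV. (s1 * m j + s2) * (w j)\<^sup>2)"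
    by (simp add: sum_distrib_left sum.distrib[symmetric] algebra_simps)
  also have "\<dots> = (\<Sum>j\<in>UNIV. (z j)\<^sup>2 / (1 + x * m j) / s2)"
    using s2 nz(2) by (intro sum.cong) (auto simp: fx wz power2_eq_square)
  finally have n: "of_nat CARD('n) = (\<Sum>j\<in>UNIV. (z j)\<^sup>2 / (1 + x * m j)) / s2"
    by (simp add: sum_divide_distrib)
  then show n': "of_nat CARD('n) * s2 = (\<Sum>j\<in>UNIV. (z j)\<^sup>2 / (1 + x * m j))"
    using s2 by simp
  have "(\<Sum>i\<in>UNIV. a i / (s1 * a i + s2)) = (\<Sum>i\<in>UNIV. a i / (1 + x * a i)) / s2"
    by (simp add: fx sum_divide_distrib mult.commute)
  moreover have "(\<Sum>j\<in>UNIV. m j * (w j)\<^sup>2)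
      = (\<Sum>j\<in>UNIV. m j * (z j)\<^sup>2 / (1 + x * m j)\<^sup>2) / s2\<^sup>2"
    by (simp add: wz sum_divide_distrib power_divide power_mult_distrib mult.commute)
  ultimately have "(\<Sum>i\<in>UNIV. a i / (1 + x * a i)) * s2
      = (\<Sum>j\<in>UNIV. m j * (z j)\<^sup>2 / (1 + x * m j)\<^sup>2)"
    using eq1 s2 by (simp add: power2_eq_square field_simps)
  then show "(\<Sum>i\<in>UNIV. a i / (1 + x * a i)) * (\<Sum>j\<in>UNIV. (z j)\<^sup>2 / (1 + x * m j))
       = of_nat CARD('n) * (\<Sum>j\<in>UNIV. m j * (z j)\<^sup>2 / (1 + x * m j)\<^sup>2)"
    unfolding n'[symmetric] by (metis mult.left_commute)
qed

section \<open>Reduction of the score equations\<close>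

lemma scalar_product_mult_left:
  "scalar_product (A *v x) y = scalar_product x (transpose A *v y)"
  for A :: "'a::comm_semiring_1^'m^'n"
  unfolding scalar_product_def matrix_vector_mult_def transpose_def
  by (simp add: sum_distrib_left sum_distrib_right mult_ac) (rule sum.swap)

lemma cmat_mult: "cmat (A ** C) = cmat A ** cmat C"
  by (simp add: matrix_matrix_mult_def vec_eq_iff)

lemma cmat_transpose: "cmat (transpose A) = transpose (cmat A)"
  by (simp add: transpose_def vec_eq_iff)

lemma cmat_mat: "cmat (mat c) = mat (complex_of_real c)"
  by (simp add: mat_def vec_eq_iff)

lemma cmat_diff: "cmat (A - C) = cmat A - cmat C"
  by (simp add: vec_eq_iff)

lemma cmat_vec: "cvec (A *v x) = cmat A *v cvec x"
  by (simp add: matrix_vector_mult_def vec_eq_iff)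

lemma cmat_conj_diag: "cmat (conj_diag Q f) = conj_diag (cmat Q) (\<lambda>i. complex_of_real (f i))"
proof -
  have "cmat (diag_mat f) = diag_mat (\<lambda>i. complex_of_real (f i))"
    by (simp add: diag_mat_def vec_eq_iff)
  then show ?thesis by (simp add: conj_diag_def cmat_mult cmat_transpose)
qed

lemma Sigma_mat_vec: "Sigma_mat V s *v x = fst s *s (cmat V *v x) + snd s *s x"
proof -
  have "map_matrix (\<lambda>a. fst s * a) (cmat V) *v x = fst s *s (cmat V *v x)"
    by (simp add: matrix_vector_mult_def vec_eq_iff sum_distrib_left mult.assoc)
  moreover have "mat (snd s) *v x = snd s *s x"
    by (simp add: mat_def matrix_vector_mult_def vec_eq_iff if_distrib if_distribR cong: if_cong)
  ultimately show ?thesis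
    by (simp add: Sigma_mat_def matrix_vector_mult_add_rdistrib)
qed

lemma conj_diag_affine:
  fixes Q :: "'a::field^'n^'n"
  assumes "Q ** transpose Q = mat 1"
  shows "conj_diag Q (\<lambda>i. c * f i + e) *v x = c *s (conj_diag Q f *v x) + e *s x"
proof -
  let ?y = "transpose Q *v x"
  have y: "Q *v ?y = x" using assms by (simp only: matrix_vector_mul_assoc matrix_vector_mul_lid)
  have cd: "conj_diag Q g *v x = Q *v (diag_mat g *v ?y)" for g
    by (simp only: conj_diag_def matrix_vector_mul_assoc matrix_mul_assoc)
  have "diag_mat (\<lambda>i. c * f i + e) *v ?y = c *s (diag_mat f *v ?y) + e *s ?y"
    by (simp add: diag_mat_vec vec_eq_iff algebra_simps)
  then show ?thesis
    by (simp only: cd matrix_vector_right_distrib vector_scalar_commute y)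
qed

text \<open>One real eigenbasis serves all complex \<open>s\<close>, since the covariance is an
  affine function of \<open>V\<close>.\<close>

lemma Sigma_mat_conj_diag:
  assumes "Q ** transpose Q = mat 1" "V = conj_diag Q a"
  shows "Sigma_mat V s = conj_diag (cmat Q) (\<lambda>i. fst s * complex_of_real (a i) + snd s)"
proof -
  have "cmat Q ** transpose (cmat Q) = mat 1"
    using arg_cong[OF assms(1), of cmat] by (simp add: cmat_mult cmat_transpose cmat_mat)
  then show ?thesis
    by (simp add: matrix_eq Sigma_mat_vec conj_diag_affine assms(2) cmat_conj_diag)
qed

section \<open>Elimination of the regression parameter by error contrasts\<close>

text \<open>The kernel of \<open>B\<close> lies in the range of \<open>X\<close>, because
  \<open>v = X *v (G *v v)\<close> there. Its dimension is at least
  \<open>CARD('n) - CARD('q) = CARD('p)\<close>, the rank of \<open>X\<close>, so the two subspaces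
  coincide.\<close>

lemma contrast_annihilates:
  fixes X :: "real^'p^'n" and B :: "real^'n^'q" and G :: "real^'n^'p"
  assumes "rank X = CARD('p)" and "CARD('p) \<le> CARD('n)"
    and "CARD('q) = CARD('n) - CARD('p)"
    and BB: "B ** transpose B = mat 1"
    and proj: "transpose B ** B = mat 1 - X ** G"
  shows "B ** X = 0"
proof -
  let ?N = "{x. B *v x = 0}"
  have N: "subspace ?N"
    by (simp add: subspace_def matrix_vector_right_distrib matrix_vector_mult_scaleR)
  have "?N \<subseteq> range ((*v) X)"
  proof
    fix v assume "v \<in> ?N"
    then have "(mat 1 - X ** G) *v v = 0"
      by (simp add: proj[symmetric] matrix_vector_mul_assoc[symmetric])
    then have "v = X *v (G *v v)"
      by (simp add: matrix_vector_mult_diff_rdistrib matrix_vector_mul_assoc)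
    then show "v \<in> range ((*v) X)" by blast
  qed
  moreover have "dim (range ((*v) X)) = CARD('p)"
    using assms(1) by (simp add: rank_dim_range)
  moreover have "dim ?N + dim (range ((*v) (transpose B))) = CARD('n)"
  proof -
    have N': "?N = {v \<in> UNIV. \<forall>u\<in>range ((*v) (transpose B)). orthogonal u v}"
      using dot_lmul_matrix[of _ B] by (auto simp: orthogonal_def) (metis inner_eq_zero_iff)
    have "subspace (range ((*v) (transpose B)))"
      by (intro linear_subspace_image subspace_UNIV matrix_vector_mul_linear)
    from dim_subspace_orthogonal_to_vectors[OF this subspace_UNIV subset_UNIV]
    show ?thesis unfolding N' by simp
  qed
  moreover have "dim (range ((*v) (transpose B))) \<le> CARD('q)"
    using dim_image_le[of "(*v) (transpose B)" UNIV] by simp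
  ultimately have "?N = range ((*v) X)"
    using N assms(2,3)
    by (intro subspace_dim_equal linear_subspace_image) auto
  then have "B *v (X *v x) = 0" for x by blast
  then show ?thesis by (simp add: matrix_eq matrix_vector_mul_assoc)
qed

text \<open>Since \<open>transpose B ** B\<close> is symmetric, the factors can be swapped; in this
  form it fixes every vector annihilated by \<open>transpose X\<close>.\<close>

lemma contrast_projection_transpose:
  fixes X :: "real^'p^'n" and B :: "real^'n^'q" and G :: "real^'n^'p"
  assumes "transpose B ** B = mat 1 - X ** G"
  shows "transpose B ** B = mat 1 - transpose G ** transpose X"
proof -
  have "transpose (mat 1 - X ** G) = mat 1 - transpose (X ** G)"
    by (simp add: transpose_def mat_def vec_eq_iff)
  then show ?thesis
    using assms[THEN arg_cong[of _ _ transpose]] by (simp add: matrix_transpose_mul)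
qed

declare transpose_matrix_vector [simp del] vector_transpose_matrix [simp del]

text \<open>Only consequences of the score equations are drawn, which is enough for an upper bound.
  The formula for \<open>cmat X *v \<beta>\<close> later recovers \<open>\<beta>\<close> from
  \<open>s\<close> and \<open>w\<close>.\<close>

lemma ml_solution_contrast:
  fixes X :: "real^'p^'n" and V Q :: "real^'n^'n" and B :: "real^'n^'q" and G :: "real^'n^'p"
  assumes BX: "B ** X = 0" and BB: "B ** transpose B = mat 1"
    and proj: "transpose B ** B = mat 1 - X ** G"
    and Q: "transpose Q ** Q = mat 1" "Q ** transpose Q = mat 1" and V: "V = conj_diag Q a"
    and sol: "(\<beta>, s) \<in> ml_solutions X V y"
  defines "f \<equiv> \<lambda>i. fst s * complex_of_real (a i) + snd s"
    and "M \<equiv> B ** V ** transpose B"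
  obtains w where "\<And>i. f i \<noteq> 0"
    "Sigma_mat M s *v w = cmat B *v cvec y"
    "cmat X *v \<beta> = cvec y - Sigma_mat V s *v (transpose (cmat B) *v w)"
    "(\<Sum>i\<in>UNIV. complex_of_real (a i) / f i) = scalar_product w (cmat M *v w)"
    "(\<Sum>i\<in>UNIV. 1 / f i) = scalar_product w w"
proof -
  let ?S = "Sigma_mat V s" and ?Q = "cmat Q" and ?B = "cmat B" and ?X = "cmat X"
  define W where "W = matrix_inv ?S"
  define r where "r = cvec y - ?X *v \<beta>"
  define u where "u = W *v r"
  define w where "w = ?B *v u"
  have Qc: "transpose ?Q ** ?Q = mat 1" "?Q ** transpose ?Q = mat 1"
    using Q[THEN arg_cong[of _ _ cmat]] by (simp_all add: cmat_mult cmat_transpose cmat_mat)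
  have BBc: "?B ** transpose ?B = mat 1"
    using BB[THEN arg_cong[of _ _ cmat]] by (simp add: cmat_mult cmat_transpose cmat_mat)
  have BXc: "?B ** ?X = 0"
    using BX[THEN arg_cong[of _ _ cmat]] by (simp add: cmat_mult) (simp add: vec_eq_iff)
  have S: "?S = conj_diag ?Q f"
    using Sigma_mat_conj_diag[OF Q(2) V] by (simp add: f_def)
  from sol have inv: "invertible ?S" and Xu: "transpose ?X *v u = 0"
    and tr1: "trace (W ** cmat V) = scalar_product r ((W ** cmat V ** W) *v r)"
    and tr2: "trace W = scalar_product r ((W ** W) *v r)"
    by (auto simp: ml_solutions_def Let_def W_def r_def u_def)
  note inverse = inverse_conj_diag[OF Qc inv[unfolded S]]
  have W: "W = conj_diag ?Q (\<lambda>i. 1 / f i)"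
    by (simp add: W_def S inverse(2))
  have SW: "?S ** W = mat 1"
    unfolding S W by (rule inverse(3))
  have tW: "transpose W = W" by (simp add: W transpose_conj_diag)
  have "transpose B ** B = mat 1 - transpose G ** transpose X"
    using proj by (rule contrast_projection_transpose)
  then have "transpose ?B ** ?B = mat 1 - transpose (cmat G) ** transpose ?X"
    by (metis cmat_mult cmat_transpose cmat_diff cmat_mat of_real_1)
  then have "transpose ?B *v w = (mat 1 - transpose (cmat G) ** transpose ?X) *v u"
    by (simp add: w_def matrix_vector_mul_assoc)
  also have "\<dots> = u - transpose (cmat G) *v (transpose ?X *v u)"
    by (simp add: matrix_vector_mult_diff_rdistrib matrix_vector_mul_assoc)
  finally have Bw: "transpose ?B *v w = u" by (simp add: Xu)
  have Su: "?S *v u = r" by (simp add: u_def matrix_vector_mul_assoc SW)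
  have Mc: "cmat M = ?B ** cmat V ** transpose ?B"
    by (simp add: M_def cmat_mult cmat_transpose)
  show thesis
  proof (rule that)
    show "f i \<noteq> 0" for i by (rule inverse(1))
    have "?B *v (?X *v \<beta>) = 0" by (simp add: matrix_vector_mul_assoc BXc)
    then have Br: "?B *v r = ?B *v cvec y"
      by (simp add: r_def matrix_vector_mult_diff_distrib)
    have "Sigma_mat M s *v w = fst s *s (?B *v (cmat V *v u)) + snd s *s w"
      by (simp add: Sigma_mat_vec Mc Bw flip: matrix_vector_mul_assoc)
    also have "\<dots> = ?B *v (?S *v u)"
      by (simp add: Sigma_mat_vec matrix_vector_right_distrib vector_scalar_commute w_def)
    finally show "Sigma_mat M s *v w = ?B *v cvec y" by (simp only: Su Br)
    show "?X *v \<beta> = cvec y - ?S *v (transpose ?B *v w)"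
      by (simp only: Bw Su) (simp add: r_def)
    have "W ** cmat V = conj_diag ?Q (\<lambda>i. 1 / f i * complex_of_real (a i))"
      by (simp only: W V cmat_conj_diag conj_diag_mult[OF Qc(1)])
    then have "(\<Sum>i\<in>UNIV. complex_of_real (a i) / f i) = trace (W ** cmat V)"
      by (simp add: trace_conj_diag Qc(1))
    \<comment> \<open>The symmetric \<open>W\<close> is moved to the left argument, so each
      quadratic form in \<open>r\<close> becomes one in \<open>u = W *v r\<close>.\<close>
    also have "\<dots> = scalar_product u (cmat V *v u)"
      by (simp add: tr1 u_def scalar_product_mult_left tW flip: matrix_vector_mul_assoc)
    also have "\<dots> = scalar_product (transpose ?B *v w) (cmat V *v u)" by (simp only: Bw)
    also have "\<dots> = scalar_product w (cmat M *v w)"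
      by (simp only: scalar_product_mult_left[of "transpose ?B"] transpose_transpose Mc
          matrix_vector_mul_assoc[symmetric] Bw[symmetric])
    finally show "(\<Sum>i\<in>UNIV. complex_of_real (a i) / f i) = scalar_product w (cmat M *v w)" .
    have "(\<Sum>i\<in>UNIV. 1 / f i) = trace W"
      by (simp add: W trace_conj_diag Qc(1))
    also have "\<dots> = scalar_product u u"
      by (simp add: tr2 u_def scalar_product_mult_left tW flip: matrix_vector_mul_assoc)
    also have "\<dots> = scalar_product (transpose ?B *v w) u" by (simp only: Bw)
    also have "\<dots> = scalar_product w w"
      by (simp add: scalar_product_mult_left w_def)
    finally show "(\<Sum>i\<in>UNIV. 1 / f i) = scalar_product w w" .
  qed
qed

lemma conj_diag_mult_vec:
  fixes P :: "'a::comm_semiring_1^'n^'n"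
  shows "conj_diag P g *v w = P *v (diag_mat g *v (transpose P *v w))"
  by (simp only: conj_diag_def matrix_vector_mul_assoc matrix_mul_assoc)

lemma scalar_product_conj_diag:
  fixes P :: "'a::comm_semiring_1^'n^'n"
  shows "scalar_product w (conj_diag P g *v w) = (\<Sum>j\<in>UNIV. g j * ((transpose P *v w) $ j)\<^sup>2)"
proof -
  have "scalar_product w (conj_diag P g *v w)
      = scalar_product (transpose P *v w) (diag_mat g *v (transpose P *v w))"
    by (simp add: conj_diag_mult_vec scalar_product_mult_left)
  then show ?thesis
    by (simp add: scalar_product_def diag_mat_vec power2_eq_square mult_ac)
qed

text \<open>In the eigenbasis of \<open>B ** V ** transpose B\<close> the contrast system decouples.
  The bilinear product gives sums of squares, not of squared moduli, so the equations stay
  algebraic.\<close>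

lemma ml_solution_spectral:
  fixes X :: "real^'p^'n" and V Q :: "real^'n^'n" and B :: "real^'n^'q" and G :: "real^'n^'p"
    and P :: "real^'q^'q"
  assumes BX: "B ** X = 0" and BB: "B ** transpose B = mat 1"
    and proj: "transpose B ** B = mat 1 - X ** G"
    and Q: "transpose Q ** Q = mat 1" "Q ** transpose Q = mat 1" and V: "V = conj_diag Q a"
    and P: "transpose P ** P = mat 1" "P ** transpose P = mat 1"
    and M: "B ** V ** transpose B = conj_diag P m"
    and sol: "(\<beta>, s) \<in> ml_solutions X V y"
  obtains w :: "complex^'q"
  where "\<And>i. fst s * complex_of_real (a i) + snd s \<noteq> 0"
    "\<And>j. (fst s * complex_of_real (m j) + snd s) * w $ j
        = complex_of_real ((transpose P *v (B *v y)) $ j)"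
    "cmat X *v \<beta> = cvec y - Sigma_mat V s *v (transpose (cmat B) *v (cmat P *v w))"
    "(\<Sum>i\<in>UNIV. complex_of_real (a i) / (fst s * complex_of_real (a i) + snd s))
        = (\<Sum>j\<in>UNIV. complex_of_real (m j) * (w $ j)\<^sup>2)"
    "(\<Sum>i\<in>UNIV. 1 / (fst s * complex_of_real (a i) + snd s)) = (\<Sum>j\<in>UNIV. (w $ j)\<^sup>2)"
proof -
  obtain w0 where w0: "\<And>i. fst s * complex_of_real (a i) + snd s \<noteq> 0"
    "Sigma_mat (B ** V ** transpose B) s *v w0 = cmat B *v cvec y"
    "cmat X *v \<beta> = cvec y - Sigma_mat V s *v (transpose (cmat B) *v w0)"
    "(\<Sum>i\<in>UNIV. complex_of_real (a i) / (fst s * complex_of_real (a i) + snd s))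
      = scalar_product w0 (cmat (B ** V ** transpose B) *v w0)"
    "(\<Sum>i\<in>UNIV. 1 / (fst s * complex_of_real (a i) + snd s)) = scalar_product w0 w0"
    using ml_solution_contrast[OF BX BB proj Q V sol] by blast
  let ?P = "cmat P" and ?w = "transpose (cmat P) *v w0"
  have Pc: "transpose ?P ** ?P = mat 1" "?P ** transpose ?P = mat 1"
    using P[THEN arg_cong[of _ _ cmat]] by (simp_all add: cmat_mult cmat_transpose cmat_mat)
  show thesis
  proof (rule that)
    show "fst s * complex_of_real (a i) + snd s \<noteq> 0" for i by (rule w0(1))
    have Pw: "?P *v ?w = w0" by (simp add: matrix_vector_mul_assoc Pc)
    then show "cmat X *v \<beta> = cvec y - Sigma_mat V s *v (transpose (cmat B) *v (?P *v ?w))"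
      by (simp only: w0(3))
    have "diag_mat (\<lambda>j. fst s * complex_of_real (m j) + snd s) *v ?w
        = transpose ?P *v (Sigma_mat (B ** V ** transpose B) s *v w0)"
      by (simp add: Sigma_mat_conj_diag[OF P(2) M] conj_diag_mult_vec matrix_vector_mul_assoc
          matrix_mul_assoc Pc)
    also have "\<dots> = cvec (transpose P *v (B *v y))"
      by (simp only: w0(2) cmat_vec cmat_transpose)
    finally show "(fst s * complex_of_real (m j) + snd s) * ?w $ j
        = complex_of_real ((transpose P *v (B *v y)) $ j)" for j
      by (simp add: diag_mat_vec vec_eq_iff)
    show "(\<Sum>i\<in>UNIV. complex_of_real (a i) / (fst s * complex_of_real (a i) + snd s))
        = (\<Sum>j\<in>UNIV. complex_of_real (m j) * (?w $ j)\<^sup>2)"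
      by (simp only: w0(4) M cmat_conj_diag scalar_product_conj_diag)
    have "w0 = conj_diag ?P (\<lambda>_. 1) *v w0"
      by (simp add: conj_diag_def diag_mat_1 Pc)
    then have "scalar_product w0 w0 = scalar_product w0 (conj_diag ?P (\<lambda>_. 1) *v w0)" by simp
    then show "(\<Sum>i\<in>UNIV. 1 / (fst s * complex_of_real (a i) + snd s)) = (\<Sum>j\<in>UNIV. (?w $ j)\<^sup>2)"
      by (simp only: w0(5) scalar_product_conj_diag mult_1)
  qed
qed

text \<open>The variance ratio \<open>h\<close> maps the solutions injectively into the root set
  \<open>Z\<close> of the secular equation.\<close>

lemma ml_solutions_card_bound:
  fixes X :: "real^'p^'n" and V Q :: "real^'n^'n" and B :: "real^'n^'q" and G :: "real^'n^'p"
    and P :: "real^'q^'q"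
  assumes rank: "rank X = CARD('p)"
    and BX: "B ** X = 0" and BB: "B ** transpose B = mat 1"
    and proj: "transpose B ** B = mat 1 - X ** G"
    and Q: "transpose Q ** Q = mat 1" "Q ** transpose Q = mat 1" and V: "V = conj_diag Q a"
    and P: "transpose P ** P = mat 1" "P ** transpose P = mat 1"
    and M: "B ** V ** transpose B = conj_diag P m"
    and a: "0 \<in> range a" "range a \<noteq> {0}" and m: "0 \<in> range m"
    and y: "\<And>j. (transpose P *v (B *v y)) $ j \<noteq> 0"
  shows "finite (ml_solutions X V y) \<and>
    int (card (ml_solutions X V y)) \<le> 2 * int (card (range m)) + int (card (range a)) - 4"
proof -
  define a' where "a' i = complex_of_real (a i)" for i
  define m' where "m' j = complex_of_real (m j)" for j
  define z where "z j = complex_of_real ((transpose P *v (B *v y)) $ j)" for j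
  define Z where "Z = {x. (\<forall>i. 1 + x * a' i \<noteq> 0) \<and> (\<forall>j. 1 + x * m' j \<noteq> 0) \<and>
     (\<Sum>i\<in>UNIV. a' i / (1 + x * a' i)) * (\<Sum>j\<in>UNIV. (z j)\<^sup>2 / (1 + x * m' j))
       = of_nat CARD('n) * (\<Sum>j\<in>UNIV. m' j * (z j)\<^sup>2 / (1 + x * m' j)\<^sup>2)}"
  let ?sol = "ml_solutions X V y"
  have ra: "range a' = complex_of_real ` range a" and rm: "range m' = complex_of_real ` range m"
    by (auto simp: a'_def m'_def)
  have card_r: "card (range a') = card (range a)" "card (range m') = card (range m)"
    unfolding ra rm by (simp_all add: card_image inj_on_def)
  have Z: "finite Z \<and> int (card Z) \<le> 2 * int (card (range m')) + int (card (range a')) - 4"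
    unfolding Z_def
  proof (rule secular_roots_bound)
    show "0 \<in> range a'" "0 \<in> range m'" using a m by (auto simp: ra rm)
    show "range a' \<noteq> {0}"
    proof
      assume "range a' = {0}"
      then have "a i = 0" for i unfolding a'_def by (metis rangeI singletonD of_real_eq_0_iff)
      then show False using a(2) by auto
    qed
    obtain j where j: "m j = 0" using m by auto
    \<comment> \<open>Complex squares could cancel; these are squares of non-zero reals, so their
      sum is positive.\<close>
    have "(\<Sum>j | m j = 0. ((transpose P *v (B *v y)) $ j)\<^sup>2) > 0"
      by (rule sum_pos2[of _ j]) (use j y in auto)
    moreover have "(\<Sum>j | m' j = 0. (z j)\<^sup>2)
        = complex_of_real (\<Sum>j | m j = 0. ((transpose P *v (B *v y)) $ j)\<^sup>2)"
      by (simp add: z_def m'_def)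
    ultimately show "(\<Sum>j | m' j = 0. (z j)\<^sup>2) \<noteq> 0"
      by (metis of_real_eq_0_iff less_irrefl)
  qed
  obtain L where "L ** X = mat 1"
    using rank by (auto simp: full_rank_injective matrix_left_invertible_injective[symmetric])
  then have L: "cmat L ** cmat X = mat 1"
    by (metis cmat_mult cmat_mat of_real_1)
  define h :: "(complex^'p) \<times> (complex \<times> complex) \<Rightarrow> complex"
    where "h = (\<lambda>(\<beta>, s). fst s / snd s)"
  have key: "\<exists>w. snd s \<noteq> 0 \<and> (\<forall>j. 1 + h (\<beta>, s) * m' j \<noteq> 0)
      \<and> (\<forall>j. (fst s * m' j + snd s) * w $ j = z j)
      \<and> cmat X *v \<beta> = cvec y - Sigma_mat V s *v (transpose (cmat B) *v (cmat P *v w))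
      \<and> of_nat CARD('n) * snd s = (\<Sum>j\<in>UNIV. (z j)\<^sup>2 / (1 + h (\<beta>, s) * m' j))
      \<and> h (\<beta>, s) \<in> Z" if sol: "(\<beta>, s) \<in> ?sol" for \<beta> s
  proof -
    obtain w :: "complex^'q" where w: "\<And>i. fst s * a' i + snd s \<noteq> 0"
      "\<And>j. (fst s * m' j + snd s) * w $ j = z j"
      "cmat X *v \<beta> = cvec y - Sigma_mat V s *v (transpose (cmat B) *v (cmat P *v w))"
      "(\<Sum>i\<in>UNIV. a' i / (fst s * a' i + snd s)) = (\<Sum>j\<in>UNIV. m' j * (w $ j)\<^sup>2)"
      "(\<Sum>i\<in>UNIV. 1 / (fst s * a' i + snd s)) = (\<Sum>j\<in>UNIV. (w $ j)\<^sup>2)"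
      using ml_solution_spectral[OF BX BB proj Q V P M sol] unfolding a'_def m'_def z_def by blast
    \<comment> \<open>At an eigenvalue \<open>0\<close> of \<open>V\<close> the non-vanishing
      diagonal entry of the covariance is \<open>snd s\<close> itself.\<close>
    obtain i where "a' i = 0" using a(1) by (auto simp: a'_def)
    with w(1)[of i] have s2: "snd s \<noteq> 0" by simp
    have "z j \<noteq> 0" for j using y by (simp add: z_def)
    then have g: "fst s * m' j + snd s \<noteq> 0" for j using w(2)[of j] by auto
    note ratio = score_equations_ratio[OF s2 w(1) g w(2) w(4) w(5)]
    show ?thesis
      using s2 w(2,3) ratio by (auto simp: Z_def h_def)
  qed
  have "inj_on h ?sol"
  proof (rule inj_onI)
    fix u u' assume u: "u \<in> ?sol" and u': "u' \<in> ?sol" and eq: "h u = h u'"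
    obtain \<beta> s where us: "u = (\<beta>, s)" by (cases u)
    obtain \<beta>' s' where us': "u' = (\<beta>', s')" by (cases u')
    obtain w where w: "snd s \<noteq> 0" "\<And>j. 1 + h (\<beta>, s) * m' j \<noteq> 0"
      "\<And>j. (fst s * m' j + snd s) * w $ j = z j"
      "cmat X *v \<beta> = cvec y - Sigma_mat V s *v (transpose (cmat B) *v (cmat P *v w))"
      "of_nat CARD('n) * snd s = (\<Sum>j\<in>UNIV. (z j)\<^sup>2 / (1 + h (\<beta>, s) * m' j))"
      using key[OF u[unfolded us]] by blast
    obtain w' where w': "snd s' \<noteq> 0"
      "\<And>j. (fst s' * m' j + snd s') * w' $ j = z j"
      "cmat X *v \<beta>' = cvec y - Sigma_mat V s' *v (transpose (cmat B) *v (cmat P *v w'))"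
      "of_nat CARD('n) * snd s' = (\<Sum>j\<in>UNIV. (z j)\<^sup>2 / (1 + h (\<beta>', s') * m' j))"
      using key[OF u'[unfolded us']] by blast
    have heq: "h (\<beta>, s) = h (\<beta>', s')" using eq us us' by simp
    \<comment> \<open>The ratio determines in turn \<open>snd s\<close>, \<open>fst s\<close>, the
      coordinates \<open>w\<close>, and finally \<open>\<beta>\<close> through the left inverse of
      \<open>X\<close>.\<close>
    have "of_nat CARD('n) * snd s = of_nat CARD('n) * snd s'"
      using w(5) w'(4) heq by simp
    then have s2: "snd s = snd s'" by simp
    then have s1: "fst s = fst s'" using heq w(1) by (simp add: h_def)
    have s: "s = s'" using s1 s2 by (rule prod_eqI)
    have g: "fst s * m' j + snd s \<noteq> 0" for j
      using w(1) w(2)[of j] by (simp add: h_def divide_simps add.commute split: if_splits)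
    have "w $ j = w' $ j" for j
      using w(3)[of j] w'(2)[of j] g[of j] unfolding s by (metis mult_left_cancel)
    then have "w = w'" by (simp add: vec_eq_iff)
    then have "cmat X *v \<beta> = cmat X *v \<beta>'" using w(4) w'(3) s by simp
    then have "\<beta> = \<beta>'"
      by (metis L matrix_vector_mul_assoc matrix_vector_mul_lid)
    then show "u = u'" using us us' s by simp
  qed
  moreover have "h ` ?sol \<subseteq> Z" using key by auto
  ultimately have "finite ?sol" "card ?sol \<le> card Z"
    using Z by (auto intro: inj_on_finite card_inj_on_le)
  then show ?thesis using Z card_r by simp
qed

section \<open>Generic data and the column space condition\<close>

text \<open>Each row of \<open>N\<close> is non-zero, so the exceptional set is a finite union of
  hyperplanes.\<close>

lemma AE_component_nonzero:
  fixes N :: "real^'n^'q"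
  assumes "N ** transpose N = mat 1"
  shows "AE y in lebesgue. \<forall>j. (N *v y) $ j \<noteq> 0"
proof -
  have "AE y in lebesgue. (N *v y) $ j \<noteq> 0" for j
  proof -
    have "(N ** transpose N) $ j $ j = 1" by (simp add: assms mat_def)
    then have "N $ j \<noteq> 0" by (auto simp: matrix_matrix_mult_def)
    then have "negligible {y. N $ j \<bullet> y = 0}" by (simp add: negligible_hyperplane)
    then show ?thesis
      unfolding eventually_ae_filter_negligible matrix_vector_mul_component by auto
  qed
  then have "AE y in lebesgue. \<forall>j\<in>UNIV. (N *v y) $ j \<noteq> 0"
    by (intro AE_finite_allI) auto
  then show ?thesis by simp
qed

text \<open>A proper subspace lies in a hyperplane; its normal vector \<open>z\<close> is orthogonal
  to the columns of both blocks.\<close>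

lemma column_space_complement:
  fixes X :: "real^'p^'n" and V :: "real^'q^'n"
  assumes "column_space (block_row X V) \<noteq> UNIV"
  obtains z where "z \<noteq> 0" "transpose X *v z = 0" "transpose V *v z = 0"
proof -
  obtain z where z: "z \<noteq> 0" "span (columns (block_row X V)) \<subseteq> {x. z \<bullet> x = 0}"
    using span_not_univ_subset_hyperplane assms unfolding column_space_def by blast
  have c: "z \<bullet> column j (block_row X V) = 0" for j
    using z(2) span_base[of "column j (block_row X V)" "columns (block_row X V)"]
    by (auto simp: columns_def)
  have "column (Inl i) (block_row X V) = column i X" "column (Inr j) (block_row X V) = column j V"
    for i j by (simp_all add: column_def block_row_def)
  then have "z \<bullet> column i X = 0" "z \<bullet> column j V = 0" for i j
    using c by metis+
  then have "transpose X *v z = 0" "transpose V *v z = 0"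
    by (simp_all add: vec_eq_iff matrix_vector_mul_component inner_commute transpose_def column_def)
  with z(1) show ?thesis by (rule that)
qed

theorem theorem3p2:
  fixes X :: "real^'p^'n" and V :: "real^'n^'n" and B :: "real^'n^'q"
    and k d0 d :: nat
  assumes "rank X = CARD('p)" and "CARD('p) < CARD('n)"
    and "symmetric_mat V" and "nonneg_definite V" and "V \<noteq> 0"
    and "rank V = k" and "k < CARD('n)"
    and "CARD('q) = CARD('n) - CARD('p)"
    and "B ** transpose B = mat 1"
    and "transpose B ** B = mat 1 - X ** mp_inverse X"
    and "d0 = card (eigenvalues V)"
    and "d = card (eigenvalues (B ** V ** transpose B))"
    and "column_space (block_row X V) \<subset> UNIV"
  shows "ml_degree_at_most X V (2 * int d + int d0 - 4)"
proof -
  let ?M = "B ** V ** transpose B"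
  have tV: "transpose V = V" using assms(3) by (simp add: symmetric_mat_def)
  then have "symmetric_mat ?M"
    by (simp add: symmetric_mat_def matrix_transpose_mul matrix_mul_assoc)
  then obtain P m where P: "transpose P ** P = mat 1" "P ** transpose P = mat 1"
    and M: "?M = conj_diag P m"
    unfolding conj_diag_def by (rule symmetric_mat_diagonalization)
  obtain Q a where Q: "transpose Q ** Q = mat 1" "Q ** transpose Q = mat 1"
    and V: "V = conj_diag Q a"
    using assms(3) unfolding conj_diag_def by (rule symmetric_mat_diagonalization)
  have ra: "eigenvalues V = range a"
    unfolding V conj_diag_def by (rule eigenvalues_diagonalized[OF Q])
  have rm: "eigenvalues ?M = range m"
    unfolding M conj_diag_def by (rule eigenvalues_diagonalized[OF P])
  have BX: "B ** X = 0"
    using assms(1) less_imp_le[OF assms(2)] assms(8-10) by (rule contrast_annihilates)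
  obtain z where z: "z \<noteq> 0" "transpose X *v z = 0" "V *v z = 0"
    using column_space_complement[of X V] assms(13) tV by auto
  have "0 \<in> eigenvalues V" using z by (auto simp: eigenvalues_def)
  then have a0: "0 \<in> range a" by (simp add: ra)
  \<comment> \<open>As \<open>transpose X *v z = 0\<close>, the projection fixes \<open>z\<close>.
    Hence \<open>B *v z\<close> is non-zero and is sent by \<open>?M\<close> to
    \<open>B *v (V *v z) = 0\<close>.\<close>
  have "(transpose B ** B) *v z = z - transpose (mp_inverse X) *v (transpose X *v z)"
    by (simp add: contrast_projection_transpose[OF assms(10)] matrix_vector_mult_diff_rdistrib
        matrix_vector_mul_assoc)
  then have Bz: "transpose B *v (B *v z) = z" by (simp add: z(2) matrix_vector_mul_assoc)
  then have "B *v z \<noteq> 0" using z(1) by auto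
  moreover have "?M *v (B *v z) = 0"
    by (simp add: Bz z(3) flip: matrix_vector_mul_assoc)
  ultimately have "0 \<in> eigenvalues ?M" by (auto simp: eigenvalues_def)
  then have m0: "0 \<in> range m" by (simp add: rm)
  have "range a \<noteq> {0}"
  proof
    assume "range a = {0}"
    then have "a = (\<lambda>_. 0)" by auto
    then have "V = 0"
      unfolding V conj_diag_def by (simp add: matrix_eq diag_mat_vec flip: matrix_vector_mul_assoc zero_vec_def)
    with assms(5) show False by simp
  qed
  note bound = ml_solutions_card_bound[OF assms(1) BX assms(9,10) Q V P M a0 this m0]
  \<comment> \<open>The map from \<open>y\<close> to its spectral coordinates has orthonormal rows,
    so almost every \<open>y\<close> has all coordinates non-zero.\<close>
  have "(transpose P ** B) ** transpose (transpose P ** B)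
      = transpose P ** (B ** transpose B) ** P"
    by (simp add: matrix_transpose_mul matrix_mul_assoc)
  then have "AE y in lebesgue. \<forall>j. ((transpose P ** B) *v y) $ j \<noteq> 0"
    by (intro AE_component_nonzero) (simp add: assms(9) P(1))
  then show ?thesis
    unfolding ml_degree_at_most_def assms(11,12) ra rm
    by eventually_elim (rule bound, simp add: matrix_vector_mul_assoc)
qed

end
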